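(* Let $t_0\in\mathcal I$ and let $a,b,c,g:\mathcal I\to\mathbb R$ be continuous functions with $a(t)\neq 0$ for all $t\in\mathcal I$. Then the iterated conformable equation $$a(t)D^{\alpha}D^{\alpha}x(t)+b(t)D^{\alpha}x(t)+c(t)x(t)=g(t),\qquad t\in\mathcal I,$$ can be written in (i.e. is equivalent to an equation of) the self-adjoint form $$D^{\alpha}[pD^{\alpha}x](t)+q(t)x(t)=h(t),\qquad t\in\mathcal I,$$ where $$p(t)=e_{\left(\frac{b}{a}+\kappa_1\right)}(t,t_0),\qquad q(t)=\frac{p(t)c(t)}{a(t)},\qquad h(t)=\frac{g(t)p(t)}{a(t)},\qquad t\in\mathcal I.$$
   Context: $\mathcal I\subseteq\mathbb R$ is a nondegenerate interval. The functions $\kappa_0,\kappa_1:[0,1]\times\mathcal I\to[0,\infty)$ are continuous and satisfy, for all $t\in\mathcal I$: $\lim_{\alpha\to0^+}\kappa_1(\alpha,t)=1$, $\lim_{\alpha\to0^+}\kappa_0(\alpha,t)=0$, $\lim_{\alpha\to1^-}\kappa_1(\alpha,t)=0$, $\lim_{\alpha\to1^-}\kappa_0(\alpha,t)=1$, $\kappa_1(\alpha,t)\ne0$ for $\alpha\in[0,1)$, and $\kappa_0(\alpha,t)\neq0$ for $\alpha\in(0,1]$. Fix $\alpha\in(0,1]$ and write $\kappa_j(t)=\kappa_j(\alpha,t)$. The conformable (proportional) derivative is $D^{\alpha}f(t)=\kappa_1(t)f(t)+\kappa_0(t)f'(t)$. For a continuous function $r$ and $t,s\in\mathcal I$, the conformable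 exponential is $e_r(t,s)=\exp\left(\int_s^t\frac{r(\tau)-\kappa_1(\tau)}{\kappa_0(\tau)}\,d\tau\right)$. *)

theory Defs
  imports "HOL-Analysis.Analysis"
begin

definition nondegenerate_interval :: "real set \<Rightarrow> bool" where
  "nondegenerate_interval I \<longleftrightarrow> is_interval I \<and> (\<exists>s\<in>I. \<exists>t\<in>I. s < t)"

text \<open>Functions with domain \<open>[0,1] \<times> I\<close> are curried total functions, constrained only for
  arguments in that domain.\<close>

definition conformable_kernels ::
    "real set \<Rightarrow> (real \<Rightarrow> real \<Rightarrow> real) \<Rightarrow> (real \<Rightarrow> real \<Rightarrow> real) \<Rightarrow> bool" where
  "conformable_kernels I \<kappa>0 \<kappa>1 \<longleftrightarrow>
     continuous_on ({0..1} \<times> I) (\<lambda>(\<alpha>, t). \<kappa>0 \<alpha> t) \<and>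
     continuous_on ({0..1} \<times> I) (\<lambda>(\<alpha>, t). \<kappa>1 \<alpha> t) \<and>
     (\<forall>\<alpha>\<in>{0..1}. \<forall>t\<in>I. 0 \<le> \<kappa>0 \<alpha> t \<and> 0 \<le> \<kappa>1 \<alpha> t) \<and>
     (\<forall>t\<in>I. ((\<lambda>\<alpha>. \<kappa>1 \<alpha> t) \<longlongrightarrow> 1) (at_right 0) \<and>
            ((\<lambda>\<alpha>. \<kappa>0 \<alpha> t) \<longlongrightarrow> 0) (at_right 0) \<and>
            ((\<lambda>\<alpha>. \<kappa>1 \<alpha> t) \<longlongrightarrow> 0) (at_left 1) \<and>
            ((\<lambda>\<alpha>. \<kappa>0 \<alpha> t) \<longlongrightarrow> 1) (at_left 1) \<and>
            (\<forall>\<alpha>\<in>{0..<1}. \<kappa>1 \<alpha> t \<noteq> 0) \<and>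
            (\<forall>\<alpha>\<in>{0<..1}. \<kappa>0 \<alpha> t \<noteq> 0))"

text \<open>From here on \<open>k0\<close> and \<open>k1\<close> are the kernels at a fixed order \<open>\<alpha>\<close>. The derivative is taken
  within \<open>I\<close>, hence one-sided at endpoints belonging to \<open>I\<close>; the value is meaningful only where
  \<open>f\<close> is differentiable, which the solution predicates below require separately.\<close>

definition conf_deriv ::
    "real set \<Rightarrow> (real \<Rightarrow> real) \<Rightarrow> (real \<Rightarrow> real) \<Rightarrow> (real \<Rightarrow> real) \<Rightarrow> real \<Rightarrow> real" where
  "conf_deriv I k0 k1 f t = k1 t * f t + k0 t * vector_derivative f (at t within I)"

text \<open>The interval integral is oriented, so \<open>t < s\<close> is allowed.\<close>

definition conf_exp ::
    "(real \<Rightarrow> real) \<Rightarrow> (real \<Rightarrow> real) \<Rightarrow> (real \<Rightarrow> real) \<Rightarrow> real \<Rightarrow> real \<Rightarrow> real" where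
  "conf_exp k0 k1 r t s = exp (LBINT \<tau>=s..t. (r \<tau> - k1 \<tau>) / k0 \<tau>)"

definition solves_iterated ::
    "real set \<Rightarrow> (real \<Rightarrow> real) \<Rightarrow> (real \<Rightarrow> real) \<Rightarrow> (real \<Rightarrow> real) \<Rightarrow> (real \<Rightarrow> real) \<Rightarrow>
     (real \<Rightarrow> real) \<Rightarrow> (real \<Rightarrow> real) \<Rightarrow> (real \<Rightarrow> real) \<Rightarrow> bool" where
  "solves_iterated I k0 k1 a b c g x \<longleftrightarrow>
     x differentiable_on I \<and>
     conf_deriv I k0 k1 x differentiable_on I \<and>
     (\<forall>t\<in>I. a t * conf_deriv I k0 k1 (conf_deriv I k0 k1 x) t
            + b t * conf_deriv I k0 k1 x t + c t * x t = g t)"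

definition solves_self_adjoint ::
    "real set \<Rightarrow> (real \<Rightarrow> real) \<Rightarrow> (real \<Rightarrow> real) \<Rightarrow> (real \<Rightarrow> real) \<Rightarrow> (real \<Rightarrow> real) \<Rightarrow>
     (real \<Rightarrow> real) \<Rightarrow> (real \<Rightarrow> real) \<Rightarrow> bool" where
  "solves_self_adjoint I k0 k1 p q h x \<longleftrightarrow>
     x differentiable_on I \<and>
     (\<lambda>s. p s * conf_deriv I k0 k1 x s) differentiable_on I \<and>
     (\<forall>t\<in>I. conf_deriv I k0 k1 (\<lambda>s. p s * conf_deriv I k0 k1 x s) t + q t * x t = h t)"

end

theory Submission
  imports Defs
begin

text \<open>The exponent of \<open>p\<close> has integrand \<open>b / (a * k0)\<close>, so \<open>k0 * p' = p * b / a\<close> and the product rule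
  gives \<open>D(p * Dx) = p * DDx + (p * b / a) * Dx\<close>. The self-adjoint equation is therefore the
  iterated one multiplied by the nowhere vanishing factor \<open>p / a\<close>. Since \<open>p\<close> is differentiable and
  positive, \<open>p * Dx\<close> is differentiable exactly when \<open>Dx\<close> is.\<close>

text \<open>A connected set with more than one point has no isolated points. Nontriviality of the
  filter makes derivatives within \<open>I\<close> unique, so \<open>vector_derivative\<close>
  returns the value computed by a derivative rule.\<close>

lemma nondegenerate_interval_at_within_neq_bot:
  assumes "nondegenerate_interval I" and "t \<in> I"
  shows "at t within I \<noteq> bot"
proof -
  obtain r s where rs: "r \<in> I" "s \<in> I" "r < s"
    using assms by (auto simp: nondegenerate_interval_def)
  have "connected I"
    using assms by (simp add: nondegenerate_interval_def is_interval_connected)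
  moreover have "I \<noteq> {z}" for z
    using rs by auto
  ultimately have "t islimpt I"
    using assms(2) connected_imp_perfect by blast
  then show ?thesis
    by (simp add: trivial_limit_within)
qed

text \<open>Reduces differentiation within an arbitrary interval, possibly open or unbounded, to a
  compact one: differentiation is local, so it suffices that \<open>{u..v}\<close> extends strictly
  beyond \<open>t\<close> on each side where \<open>I\<close> does. Including \<open>t0\<close>
  makes room for the base point of an integral.\<close>

lemma interval_at_within_compact_subinterval:
  fixes I :: "real set"
  assumes I: "is_interval I" and t: "t \<in> I" and t0: "t0 \<in> I"
  obtains u v where "{u..v} \<subseteq> I" "t \<in> {u..v}" "t0 \<in> {u..v}"
    and "at t within I = at t within {u..v}"
proof -
  obtain u where u: "u \<in> I" "u \<le> t" "u \<le> t0" "u < t \<or> (\<forall>s\<in>I. t \<le> s)"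
  proof (cases "\<exists>s\<in>I. s < t")
    case True
    then obtain s where "s \<in> I" "s < t" by blast
    with t0 show ?thesis by (intro that[of "min s t0"]) (auto simp: min_def)
  next
    case False
    with t t0 show ?thesis by (intro that[of t]) (auto simp: not_less)
  qed
  obtain v where v: "v \<in> I" "t \<le> v" "t0 \<le> v" "t < v \<or> (\<forall>s\<in>I. s \<le> t)"
  proof (cases "\<exists>s\<in>I. t < s")
    case True
    then obtain s where "s \<in> I" "t < s" by blast
    with t0 show ?thesis by (intro that[of "max s t0"]) (auto simp: max_def)
  next
    case False
    with t t0 show ?thesis by (intro that[of t]) (auto simp: not_less)
  qed
  have sub: "{u..v} \<subseteq> I"
    using mem_is_interval_1_I[OF I u(1) v(1)] by auto
  let ?S = "{x. (u < t \<longrightarrow> u < x) \<and> (t < v \<longrightarrow> x < v)}"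
  have "at t within I = at t within {u..v}"
  proof (rule at_within_nhd[of t ?S])
    show "open ?S"
      by (cases "u < t"; cases "t < v") (simp_all add: open_Collect_conj open_Collect_less)
    show "I \<inter> ?S - {t} = {u..v} \<inter> ?S - {t}"
    proof (intro equalityI subsetI)
      fix s
      assume s: "s \<in> I \<inter> ?S - {t}"
      then have "u \<le> s" "s \<le> v"
        using u(2,4) v(2,4) by force+
      with s show "s \<in> {u..v} \<inter> ?S - {t}"
        by simp
    qed (use sub in blast)
  qed simp
  then show ?thesis
    using that[OF sub] u(2,3) v(2,3) by simp
qed

lemma interval_integral_has_real_derivative:
  fixes f :: "real \<Rightarrow> real"
  assumes I: "is_interval I" and f: "continuous_on I f" and t0: "t0 \<in> I" and t: "t \<in> I"
  shows "((\<lambda>u. LBINT y=t0..u. f y) has_real_derivative f t) (at t within I)"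
proof -
  obtain u v where uv: "{u..v} \<subseteq> I" "t \<in> {u..v}" "t0 \<in> {u..v}"
    and eq: "at t within I = at t within {u..v}"
    using interval_at_within_compact_subinterval[OF I t t0] .
  have "continuous_on {u..v} f"
    using f uv(1) continuous_on_subset by blast
  then show ?thesis
    using uv interval_integral_FTC2[of u t0 v f t]
    by (simp add: eq has_real_derivative_iff_has_vector_derivative)
qed

lemma conf_exp_has_real_derivative:
  assumes "is_interval I" and r: "continuous_on I r"
    and k: "continuous_on I k0" "continuous_on I k1" "\<forall>t\<in>I. k0 t \<noteq> 0"
    and t: "s \<in> I" "t \<in> I"
  shows "((\<lambda>t. conf_exp k0 k1 r t s) has_real_derivative
           conf_exp k0 k1 r t s * ((r t - k1 t) / k0 t)) (at t within I)"
proof -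
  have "continuous_on I (\<lambda>\<tau>. (r \<tau> - k1 \<tau>) / k0 \<tau>)"
    using r k by (intro continuous_intros) auto
  from interval_integral_has_real_derivative[OF assms(1) this t] show ?thesis
    unfolding conf_exp_def by (rule DERIV_chain2[OF DERIV_exp])
qed

text \<open>Continuity follows by composing with \<open>Pair \<alpha>\<close>. The strict bound
  \<open>0 < \<alpha>\<close> gives the last claim, since \<open>\<kappa>0\<close> tends to zero as
  the order tends to 0 from the right.\<close>

lemma conformable_kernels_slice:
  assumes "conformable_kernels I \<kappa>0 \<kappa>1" and "0 < \<alpha>" and "\<alpha> \<le> 1"
  shows "continuous_on I (\<kappa>0 \<alpha>)" and "continuous_on I (\<kappa>1 \<alpha>)" and "\<forall>t\<in>I. \<kappa>0 \<alpha> t \<noteq> 0"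
proof -
  have slice: "continuous_on I (k \<alpha>)"
    if "continuous_on ({0..1} \<times> I) (\<lambda>(\<alpha>, t). k \<alpha> t)" for k :: "real \<Rightarrow> real \<Rightarrow> real"
  proof -
    have "continuous_on I ((\<lambda>(\<alpha>, t). k \<alpha> t) \<circ> Pair \<alpha>)"
      using assms(2,3)
      by (intro continuous_on_compose continuous_intros continuous_on_subset[OF that]) auto
    then show ?thesis by (simp add: o_def)
  qed
  show "continuous_on I (\<kappa>0 \<alpha>)" "continuous_on I (\<kappa>1 \<alpha>)" "\<forall>t\<in>I. \<kappa>0 \<alpha> t \<noteq> 0"
    using assms slice by (auto simp: conformable_kernels_def)
qed

text \<open>The conformable derivative does not obey the Leibniz rule, because of its zeroth-order
  term. Here that term goes entirely to the factor \<open>y\<close>, so \<open>p\<close> enters only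
  through its ordinary derivative.\<close>

lemma conf_deriv_mult:
  assumes "at t within I \<noteq> bot" and y: "y differentiable (at t within I)"
    and p: "(p has_real_derivative p') (at t within I)"
  shows "conf_deriv I k0 k1 (\<lambda>s. p s * y s) t = p t * conf_deriv I k0 k1 y t + k0 t * p' * y t"
proof -
  have y': "(y has_real_derivative vector_derivative y (at t within I)) (at t within I)"
    using y by (simp add: has_real_derivative_iff_has_vector_derivative vector_derivative_works)
  have "vector_derivative (\<lambda>s. p s * y s) (at t within I)
      = p' * y t + vector_derivative y (at t within I) * p t"
    using DERIV_mult[OF p y'] assms(1)
    by (intro vector_derivative_within)
       (auto simp: has_real_derivative_iff_has_vector_derivative)
  then show ?thesis
    by (simp add: conf_deriv_def algebra_simps)
qed

theorem theorem3p2: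
  fixes I :: "real set" and \<kappa>0 \<kappa>1 :: "real \<Rightarrow> real \<Rightarrow> real" and \<alpha> t0 :: real
    and a b c g p q h :: "real \<Rightarrow> real"
  assumes "nondegenerate_interval I"
    and "conformable_kernels I \<kappa>0 \<kappa>1"
    and "0 < \<alpha>" and "\<alpha> \<le> 1"
    and "t0 \<in> I"
    and "continuous_on I a" and "continuous_on I b" and "continuous_on I c" and "continuous_on I g"
    and "\<forall>t\<in>I. a t \<noteq> 0"
    and "\<forall>t\<in>I. p t = conf_exp (\<kappa>0 \<alpha>) (\<kappa>1 \<alpha>) (\<lambda>\<tau>. b \<tau> / a \<tau> + \<kappa>1 \<alpha> \<tau>) t t0"
    and "\<forall>t\<in>I. q t = p t * c t / a t"
    and "\<forall>t\<in>I. h t = g t * p t / a t"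
  shows "\<forall>x. solves_iterated I (\<kappa>0 \<alpha>) (\<kappa>1 \<alpha>) a b c g x
             \<longleftrightarrow> solves_self_adjoint I (\<kappa>0 \<alpha>) (\<kappa>1 \<alpha>) p q h x"
proof -
  let ?k0 = "\<kappa>0 \<alpha>" and ?k1 = "\<kappa>1 \<alpha>"
  note k = conformable_kernels_slice[OF assms(2-4)]
  have I: "is_interval I"
    using assms(1) by (simp add: nondegenerate_interval_def)
  have p_pos: "p t > 0" if "t \<in> I" for t
    using that assms(11) by (simp add: conf_exp_def)
  have p_deriv: "(p has_real_derivative p t * (b t / a t / ?k0 t)) (at t within I)"
    if t: "t \<in> I" for t
  proof -
    have "continuous_on I (\<lambda>\<tau>. b \<tau> / a \<tau> + ?k1 \<tau>)"
      using assms(6,7,10) k by (intro continuous_intros) auto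
    from conf_exp_has_real_derivative[OF I this k assms(5) t] show ?thesis
      using t assms(11)
      \<comment> \<open>\<open>p\<close> agrees with the exponential only on \<open>I\<close>, which
        suffices for a derivative within \<open>I\<close>; the radius 1 is arbitrary.\<close>
      by (auto intro: has_field_derivative_transform_within[of _ _ t I 1])
  qed
  then have p_diff: "p differentiable_on I"
    by (meson differentiable_on_def field_differentiable_def field_differentiable_imp_differentiable)
  show ?thesis
  proof
    fix x
    define y where "y = conf_deriv I ?k0 ?k1 x"
    have "y differentiable_on I" if py: "(\<lambda>s. p s * y s) differentiable_on I"
      unfolding differentiable_on_def
    proof
      fix t
      assume t: "t \<in> I"
      \<comment> \<open>The quotient equals \<open>y\<close> on \<open>I\<close>, where
        \<open>p\<close> is known to be positive.\<close>
      have "(\<lambda>s. p s * y s / p s) differentiable (at t within I)"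
        using py p_diff p_pos[OF t] t unfolding differentiable_on_def
        by (intro differentiable_divide) auto
      then show "y differentiable (at t within I)"
        by (rule differentiable_transform_within[where d = 1])
           (use t p_pos in \<open>force+\<close>)
    qed
    then have diff_iff: "(\<lambda>s. p s * y s) differentiable_on I \<longleftrightarrow> y differentiable_on I"
      using p_diff by (auto intro: differentiable_on_mult)
    \<comment> \<open>The product rule requires \<open>y\<close> to be differentiable. Both solution
      predicates supply this, the self-adjoint one through \<open>diff_iff\<close>.\<close>
    have eq_iff: "conf_deriv I ?k0 ?k1 (\<lambda>s. p s * y s) t + q t * x t = h t \<longleftrightarrow>
        a t * conf_deriv I ?k0 ?k1 y t + b t * y t + c t * x t = g t"
      if t: "t \<in> I" and y: "y differentiable_on I" for t
    proof -
      let ?L = "a t * conf_deriv I ?k0 ?k1 y t + b t * y t + c t * x t"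
      have nz: "a t \<noteq> 0" "?k0 t \<noteq> 0" "p t / a t \<noteq> 0"
        using t assms(10) k(3) p_pos[OF t] by auto
      have "conf_deriv I ?k0 ?k1 (\<lambda>s. p s * y s) t
          = p t * conf_deriv I ?k0 ?k1 y t + ?k0 t * (p t * (b t / a t / ?k0 t)) * y t"
        using nondegenerate_interval_at_within_neq_bot[OF assms(1) t] y t p_deriv[OF t]
        by (intro conf_deriv_mult) (auto simp: differentiable_on_def)
      then have "conf_deriv I ?k0 ?k1 (\<lambda>s. p s * y s) t + q t * x t = p t / a t * ?L"
        using nz t assms(12) by (simp add: field_simps)
      moreover have "h t = p t / a t * g t"
        using t assms(13) by simp
      ultimately show ?thesis
        using nz(3) by (metis mult_left_cancel)
    qed
    show "solves_iterated I ?k0 ?k1 a b c g x \<longleftrightarrow> solves_self_adjoint I ?k0 ?k1 p q h x"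
      unfolding solves_iterated_def solves_self_adjoint_def y_def[symmetric]
      using diff_iff eq_iff by auto
  qed
qed

end
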